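(* Let $H$ be a real Hilbert space and let $f, g \in \Gamma_0(H)$ with $\mathrm{dom}(f) \cap \mathrm{dom}(g) \neq \emptyset$. Consider the conditions (C1) $\partial(f+g) = \partial f + \partial g$; (C2) for all $x \in H$, $\partial g(x) \subset \partial g(\mathrm{prox}_f(x))$; (C3) for all $x \in H$, $\partial g(\mathrm{prox}_f(x)) \subset \partial g(x)$. Then: (i) If (C2) is satisfied, then $\mathrm{prox}_g(x) \in \mathrm{prox}^f_g(x)$ for all $x \in H$. (ii) If (C1) and (C3) are satisfied, then $\mathrm{prox}^f_g(x) = \mathrm{prox}_g(x)$ for all $x \in H$ (i.e. $\mathrm{prox}^f_g(x)$ is the singleton $\{\mathrm{prox}_g(x)\}$). In both cases, (C1) is satisfied and the equality $\mathrm{prox}_{f+g} = \mathrm{prox}_f \circ \mathrm{prox}_g$ holds true.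
   Context: $\Gamma_0(H)$ is the set of proper, lower semicontinuous, convex functions $H \to \mathbb{R} \cup \{+\infty\}$. For $g : H \to \mathbb{R}\cup\{+\infty\}$, $\mathrm{dom}(g) = \{x \in H : g(x) < +\infty\}$. For $g \in \Gamma_0(H)$, the subdifferential is the set-valued map $\partial g(x) = \{ y \in H : \langle y, z-x\rangle \le g(z)-g(x)\ \forall z \in H\}$. Sums of set-valued maps are pointwise Minkowski sums (empty if one of the summands is empty). For a set-valued map $A : H \rightrightarrows H$, $A^{-1}(y) = \{x \in H : y \in A(x)\}$; $I$ is the identity operator. The proximal operator of $g \in \Gamma_0(H)$ is $\mathrm{prox}_g = (I+\partial g)^{-1}$, which is single-valued and defined everywhere on $H$. The $f$-proximal operator of $g$ is the set-valued map $\mathrm{prox}^f_g : H \rightrightarrows H$ defined by $\mathrm{prox}^f_g = (I + \partial g \circ \mathrm{prox}_f)^{-1}$; that is, $y \in \mathrm{prox}^f_g(x)$ if and only if $x - y \in \partial g(\mathrm{prox}_f(y))$. *)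

theory Defs
  imports "HOL-Analysis.Analysis"
begin

text \<open>
  A real Hilbert space is a type of sort \<open>{real_inner, complete_space}\<close>. Functions with values in
  \<open>(-\<infinity>, +\<infinity>]\<close> are \<open>ereal\<close>-valued functions that avoid the value \<open>-\<infinity>\<close>; this is part of
  membership in \<open>Gamma0\<close>. On such values the sum of \<open>ereal\<close>s is the usual one.
\<close>

definition edom :: "('a \<Rightarrow> ereal) \<Rightarrow> 'a set" where
  "edom g = {x. g x < \<infinity>}"

definition eproper :: "('a \<Rightarrow> ereal) \<Rightarrow> bool" where
  "eproper g \<longleftrightarrow> (\<forall>x. g x \<noteq> -\<infinity>) \<and> edom g \<noteq> {}"

definition elsc :: "('a::topological_space \<Rightarrow> ereal) \<Rightarrow> bool" where
  "elsc g \<longleftrightarrow> (\<forall>x. g x \<le> Liminf (at x) g)"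

text \<open>The endpoints \<open>t = 0\<close> and \<open>t = 1\<close> are harmless, since \<open>0 * \<infinity> = 0\<close> in \<open>ereal\<close>.\<close>

definition econvex :: "('a::real_vector \<Rightarrow> ereal) \<Rightarrow> bool" where
  "econvex g \<longleftrightarrow> (\<forall>x y. \<forall>t\<in>{0..1::real}.
     g ((1 - t) *\<^sub>R x + t *\<^sub>R y) \<le> ereal (1 - t) * g x + ereal t * g y)"

definition Gamma0 :: "('a::{real_inner, complete_space} \<Rightarrow> ereal) set" where
  "Gamma0 = {g. eproper g \<and> elsc g \<and> econvex g}"

text \<open>
  In \<open>ereal\<close> we have \<open>\<infinity> - \<infinity> = \<infinity>\<close>, so the points \<open>z\<close> outside the domain of \<open>g\<close> impose no
  condition; for proper \<open>g\<close> the set \<open>subdiff g x\<close> is empty whenever \<open>g x = \<infinity>\<close>, because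
  \<open>g z - g x = -\<infinity>\<close> for \<open>z\<close> in the domain.
\<close>

definition subdiff :: "('a::real_inner \<Rightarrow> ereal) \<Rightarrow> 'a \<Rightarrow> 'a set" where
  "subdiff g x = {y. \<forall>z. ereal (y \<bullet> (z - x)) \<le> g z - g x}"

definition sv_inverse :: "('a \<Rightarrow> 'b set) \<Rightarrow> 'b \<Rightarrow> 'a set" where
  "sv_inverse A y = {x. y \<in> A x}"

text \<open>
  Sums of sets are the Minkowski sums of \<open>HOL-Library.Set_Algebras\<close>. The description in \<open>prox\<close> is
  meaningful for \<open>g \<in> Gamma0\<close>, where the inverse of \<open>I + \<partial>g\<close> is single-valued with full domain.
\<close>

definition prox :: "('a::{real_inner, complete_space} \<Rightarrow> ereal) \<Rightarrow> 'a \<Rightarrow> 'a" where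
  "prox g x = (THE y. y \<in> sv_inverse (\<lambda>u. {u} + subdiff g u) x)"

definition fprox ::
  "('a::{real_inner, complete_space} \<Rightarrow> ereal) \<Rightarrow> ('a \<Rightarrow> ereal) \<Rightarrow> 'a \<Rightarrow> 'a set" where
  "fprox f g = sv_inverse (\<lambda>u. {u} + subdiff g (prox f u))"

definition C1 :: "('a::real_inner \<Rightarrow> ereal) \<Rightarrow> ('a \<Rightarrow> ereal) \<Rightarrow> bool" where
  "C1 f g \<longleftrightarrow> (\<forall>x. subdiff (\<lambda>u. f u + g u) x = subdiff f x + subdiff g x)"

definition C2 ::
  "('a::{real_inner, complete_space} \<Rightarrow> ereal) \<Rightarrow> ('a \<Rightarrow> ereal) \<Rightarrow> bool" where
  "C2 f g \<longleftrightarrow> (\<forall>x. subdiff g x \<subseteq> subdiff g (prox f x))"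

definition C3 ::
  "('a::{real_inner, complete_space} \<Rightarrow> ereal) \<Rightarrow> ('a \<Rightarrow> ereal) \<Rightarrow> bool" where
  "C3 f g \<longleftrightarrow> (\<forall>x. subdiff g (prox f x) \<subseteq> subdiff g x)"

end

theory Submission
  imports Defs
begin

text \<open>
  Once it is known that every \<open>x\<close> has exactly one \<open>y\<close> with \<open>x - y \<in> \<partial>g(y)\<close>, so that
  \<open>y = prox g x\<close> means just this (lemma \<open>eq_prox_iff\<close>), the rest is bookkeeping with
  subgradients. Put \<open>y = prox g x\<close> and \<open>z = prox f y\<close>. If \<open>y\<close> lies in \<open>fprox f g x\<close>,
  then \<open>y - z \<in> \<partial>f(z)\<close> and \<open>x - y \<in> \<partial>g(z)\<close>, and these add up to
  \<open>x - z \<in> \<partial>f(z) + \<partial>g(z) \<subseteq> \<partial>(f + g)(z)\<close>, which says \<open>z = prox (f + g) x\<close>.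
  As every subgradient of \<open>f + g\<close> at \<open>z\<close> has the form \<open>x - z\<close> with \<open>z = prox (f + g) x\<close>,
  the sum rule \<open>C1\<close> comes along (lemma \<open>prox_add_eq_comp_and_C1\<close>). So in both parts the
  task is to show \<open>prox g x \<in> fprox f g x\<close>.

  Under \<open>C2\<close> this is immediate, since \<open>x - y \<in> \<partial>g(y) \<subseteq> \<partial>g(prox f y)\<close>. Under \<open>C3\<close> the
  reverse inclusion gives \<open>fprox f g x \<subseteq> {prox g x}\<close>, and \<open>C1\<close> makes the left-hand side
  nonempty (lemma \<open>C1_imp_fprox_nonempty\<close>).

  The analytic content is the existence of the proximal point. It is obtained by minimizing
  \<open>g + \<parallel>\<cdot> - x\<parallel>\<^sup>2 / 2\<close>: this function is bounded below (lemma
  \<open>Gamma0_linear_lower_bound\<close>), its minimizing sequences are Cauchy by strong convexity, and the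
  optimality condition at the minimizer is the subgradient inequality.
\<close>

section \<open>Real-valued descriptions\<close>

lemma Gamma0_not_MInf: "g \<in> Gamma0 \<Longrightarrow> g x \<noteq> -\<infinity>"
  by (auto simp: Gamma0_def eproper_def)

lemma Gamma0_has_real_value:
  assumes "g \<in> Gamma0"
  obtains x r where "g x = ereal r"
proof -
  from assms obtain x where "g x < \<infinity>"
    by (auto simp: Gamma0_def eproper_def edom_def)
  with Gamma0_not_MInf[OF assms] that show thesis
    by (cases "g x") auto
qed

lemma Gamma0_convexD:
  assumes "g \<in> Gamma0" "g x = ereal r" "g y = ereal s" "0 \<le> t" "t \<le> 1"
  obtains q where "g ((1 - t) *\<^sub>R x + t *\<^sub>R y) = ereal q" "q \<le> (1 - t) * r + t * s"
proof -
  have "g ((1 - t) *\<^sub>R x + t *\<^sub>R y) \<le> ereal (1 - t) * g x + ereal t * g y"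
    using assms(1,4,5) by (simp add: Gamma0_def econvex_def)
  with assms(2,3) Gamma0_not_MInf[OF assms(1)] that show thesis
    by (cases "g ((1 - t) *\<^sub>R x + t *\<^sub>R y)") auto
qed

lemma Gamma0_lscD:
  assumes "g \<in> Gamma0" "c < g x"
  shows "eventually (\<lambda>u. c < g u) (nhds x)"
  using assms by (auto simp: Gamma0_def elsc_def le_Liminf_iff eventually_nhds_conv_at)

text \<open>
  A subgradient at \<open>x\<close> forces \<open>g x\<close> to be finite, and then only the points \<open>z\<close> of the domain
  impose a condition; so subgradient inequalities can be added as real inequalities.
\<close>

lemma subdiff_real_iff:
  assumes "g \<in> Gamma0"
  shows "y \<in> subdiff g x \<longleftrightarrow>
    (\<exists>r. g x = ereal r \<and> (\<forall>z s. g z = ereal s \<longrightarrow> y \<bullet> (z - x) \<le> s - r))"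
proof
  assume y: "y \<in> subdiff g x"
  obtain z s where "g z = ereal s"
    using Gamma0_has_real_value[OF assms] .
  moreover have "ereal (y \<bullet> (z - x)) \<le> g z - g x"
    using y by (simp add: subdiff_def)
  ultimately obtain r where r: "g x = ereal r"
    using Gamma0_not_MInf[OF assms, of x] by (cases "g x") auto
  have "y \<bullet> (z - x) \<le> s - r" if "g z = ereal s" for z s
  proof -
    have "ereal (y \<bullet> (z - x)) \<le> g z - g x"
      using y by (simp add: subdiff_def)
    with r that show ?thesis by simp
  qed
  with r show "\<exists>r. g x = ereal r \<and> (\<forall>z s. g z = ereal s \<longrightarrow> y \<bullet> (z - x) \<le> s - r)"
    by blast
next
  assume "\<exists>r. g x = ereal r \<and> (\<forall>z s. g z = ereal s \<longrightarrow> y \<bullet> (z - x) \<le> s - r)"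
  then obtain r where r: "g x = ereal r"
    and le: "\<And>z s. g z = ereal s \<Longrightarrow> y \<bullet> (z - x) \<le> s - r" by blast
  have "ereal (y \<bullet> (z - x)) \<le> g z - g x" for z
    using Gamma0_not_MInf[OF assms, of z] r le by (cases "g z") auto
  then show "y \<in> subdiff g x" by (simp add: subdiff_def)
qed

text \<open>
  This replaces the affine minorant that the Hahn-Banach theorem would give, because a decay that
  is at most linear cannot outweigh \<open>\<parallel>\<cdot> - x\<parallel>\<^sup>2 / 2\<close>. It is elementary: lower semicontinuity
  bounds \<open>g\<close> below near a point \<open>a\<close> of its domain, and convexity on the segment from \<open>a\<close> to \<open>u\<close>
  turns this local bound into a bound at \<open>u\<close>.
\<close>

lemma Gamma0_linear_lower_bound:
  assumes "g \<in> Gamma0"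
  obtains C b a where "C \<ge> 0" "\<And>u s. g u = ereal s \<Longrightarrow> b - C * norm (u - a) \<le> s"
proof -
  obtain a r where a: "g a = ereal r"
    using Gamma0_has_real_value[OF assms] .
  then have "eventually (\<lambda>u. ereal (r - 1) < g u) (nhds a)"
    by (intro Gamma0_lscD[OF assms]) simp
  then obtain d where d: "d > 0" "\<And>u. dist u a < d \<Longrightarrow> ereal (r - 1) < g u"
    by (auto simp: eventually_nhds_metric)
  have "(r - 1) - 2 / d * norm (u - a) \<le> s" if u: "g u = ereal s" for u s
  proof (cases "norm (u - a) < d")
    case True
    then have "ereal (r - 1) < g u"
      by (intro d(2)) (simp add: dist_norm)
    moreover have "0 \<le> 2 / d * norm (u - a)"
      using d(1) by simp
    ultimately show ?thesis using u by simp
  next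
    case False
    \<comment> \<open>The point at distance \<open>d / 2\<close> from \<open>a\<close> on the segment towards \<open>u\<close>.\<close>
    define t where "t = d / (2 * norm (u - a))"
    have n: "norm (u - a) > 0" using False d(1) by linarith
    have t: "0 < t" "t \<le> 1" "t * norm (u - a) = d / 2"
      using n False d(1) by (auto simp: t_def field_simps)
    obtain q where q: "g ((1 - t) *\<^sub>R a + t *\<^sub>R u) = ereal q" "q \<le> (1 - t) * r + t * s"
      using Gamma0_convexD[OF assms a u, of t] t by auto
    have "(1 - t) *\<^sub>R a + t *\<^sub>R u - a = t *\<^sub>R (u - a)"
      by (simp add: algebra_simps)
    then have "ereal (r - 1) < g ((1 - t) *\<^sub>R a + t *\<^sub>R u)"
      using t d(1) by (intro d(2)) (simp add: dist_norm)
    with q have "- 1 < t * (s - r)" by (simp add: algebra_simps)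
    then have "- (1 / t) < s - r"
      using t(1) by (simp add: field_simps)
    moreover have "1 / t = 2 / d * norm (u - a)"
      using n d(1) by (simp add: t_def field_simps)
    ultimately show ?thesis by linarith
  qed
  with d(1) show thesis by (intro that[of "2 / d"]) auto
qed

section \<open>The proximal point\<close>

text \<open>
  By the parallelogram law, the value of \<open>u \<mapsto> g u + \<parallel>u - x\<parallel>\<^sup>2 / 2\<close> at a midpoint is smaller
  than the mean of the values at the two end points \<open>v\<close>, \<open>w\<close> by at least \<open>\<parallel>v - w\<parallel>\<^sup>2 / 8\<close>, so a minimizing sequence is Cauchy; lower
  semicontinuity makes its limit a minimizer.
\<close>

lemma Gamma0_regularization_has_minimizer:
  assumes "g \<in> Gamma0"
  obtains y r where "g y = ereal r"
    "\<And>z s. g z = ereal s \<Longrightarrow> r + (norm (y - x))\<^sup>2 / 2 \<le> s + (norm (z - x))\<^sup>2 / 2"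
proof -
  define V where "V = {s + (norm (u - x))\<^sup>2 / 2 | u s. g u = ereal s}"
  define m where "m = Inf V"
  have ne: "V \<noteq> {}"
    using Gamma0_has_real_value[OF assms] unfolding V_def by blast
  obtain C b a where C: "C \<ge> 0" "\<And>u s. g u = ereal s \<Longrightarrow> b - C * norm (u - a) \<le> s"
    using Gamma0_linear_lower_bound[OF assms] by metis
  \<comment> \<open>Completing the square: \<open>\<rho>\<^sup>2 / 2 - C \<rho>\<close> is minimal at \<open>\<rho> = C\<close>, with value \<open>- C\<^sup>2 / 2\<close>.\<close>
  have "b - C * norm (x - a) - C\<^sup>2 / 2 \<le> s + (norm (u - x))\<^sup>2 / 2" if "g u = ereal s" for u s
  proof -
    have "norm (u - a) \<le> norm (u - x) + norm (x - a)"
      using norm_triangle_ineq[of "u - x" "x - a"] by simp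
    then have "C * norm (u - a) \<le> C * norm (u - x) + C * norm (x - a)"
      using C(1) mult_left_mono by (fastforce simp: distrib_left)
    moreover have "0 \<le> (norm (u - x) - C)\<^sup>2" by simp
    then have "2 * (C * norm (u - x)) \<le> (norm (u - x))\<^sup>2 + C\<^sup>2"
      by (simp add: power2_eq_square algebra_simps)
    ultimately show ?thesis using C(2)[OF that] by linarith
  qed
  then have bdd: "bdd_below V"
    unfolding V_def by (intro bdd_belowI[of _ "b - C * norm (x - a) - C\<^sup>2 / 2"]) auto
  have m_le: "m \<le> s + (norm (u - x))\<^sup>2 / 2" if "g u = ereal s" for u s
    unfolding m_def using that by (intro cInf_lower[OF _ bdd]) (auto simp: V_def)
  have "\<exists>u s. g u = ereal s \<and> s + (norm (u - x))\<^sup>2 / 2 < m + inverse (real (Suc n))" for n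
    using cInf_lessD[OF ne, of "m + inverse (real (Suc n))"] by (force simp: m_def V_def)
  then obtain u s where us: "\<And>n. g (u n) = ereal (s n)"
    "\<And>n. s n + (norm (u n - x))\<^sup>2 / 2 < m + inverse (real (Suc n))"
    by metis
  have close: "(norm (u n - u k))\<^sup>2 \<le> 4 * inverse (real (Suc n)) + 4 * inverse (real (Suc k))"
    for n k
  proof -
    obtain q where q: "g ((1 - 1/2) *\<^sub>R u n + (1/2) *\<^sub>R u k) = ereal q"
      "q \<le> (1 - 1/2) * s n + 1/2 * s k"
      using Gamma0_convexD[OF assms us(1)[of n] us(1)[of k], of "1/2"] by auto
    define p where "p = u n - x"
    define w where "w = u k - x"
    have "(1 - 1/2) *\<^sub>R u n + (1/2) *\<^sub>R u k - x = (1/2) *\<^sub>R (p + w)"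
      by (simp add: p_def w_def algebra_simps flip: scaleR_2)
    then have "m \<le> q + (norm ((1/2) *\<^sub>R (p + w)))\<^sup>2 / 2"
      using m_le[OF q(1)] by simp
    also have "(norm ((1/2) *\<^sub>R (p + w)))\<^sup>2 = (norm p)\<^sup>2 / 2 + (norm w)\<^sup>2 / 2 - (norm (p - w))\<^sup>2 / 4"
      by (simp add: power2_norm_eq_inner inner_add inner_diff inner_commute field_simps)
    also have "p - w = u n - u k" by (simp add: p_def w_def)
    finally show ?thesis
      using q(2) us(2)[of n] us(2)[of k] by (simp add: p_def w_def add_divide_distrib diff_divide_distrib)
  qed
  have inv: "(\<lambda>n. inverse (real (Suc n))) \<longlonglongrightarrow> 0"
    by (rule LIMSEQ_inverse_real_of_nat)
  have "Cauchy u"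
  proof (rule metric_CauchyI)
    fix e :: real assume e: "e > 0"
    then have "eventually (\<lambda>n. inverse (real (Suc n)) < e\<^sup>2 / 8) sequentially"
      by (intro order_tendstoD(2)[OF inv]) simp
    then obtain N where N: "\<And>n. n \<ge> N \<Longrightarrow> inverse (real (Suc n)) < e\<^sup>2 / 8"
      by (auto simp: eventually_sequentially)
    have "dist (u n) (u k) < e" if "n \<ge> N" "k \<ge> N" for n k
    proof -
      have "(norm (u n - u k))\<^sup>2 < e\<^sup>2"
        using close[of n k] N[OF that(1)] N[OF that(2)] by linarith
      then show ?thesis using e by (simp add: dist_norm power2_less_imp_less)
    qed
    then show "\<exists>N. \<forall>m\<ge>N. \<forall>n\<ge>N. dist (u m) (u n) < e" by blast
  qed
  then obtain y where y: "u \<longlonglongrightarrow> y"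
    using Cauchy_convergent_iff convergent_def by blast
  \<comment> \<open>The norms \<open>\<parallel>u n - x\<parallel>\<close> converge, so the values \<open>s n\<close> are asymptotically at most \<open>c\<close>.\<close>
  define c where "c = m - (norm (y - x))\<^sup>2 / 2"
  have lim: "(\<lambda>n. m + inverse (real (Suc n)) - (norm (u n - x))\<^sup>2 / 2) \<longlonglongrightarrow> m + 0 - (norm (y - x))\<^sup>2 / 2"
    by (intro tendsto_intros y inv) simp
  have gy: "g y \<le> ereal c"
  proof (rule ccontr)
    assume "\<not> g y \<le> ereal c"
    then obtain c' where c': "ereal c < ereal c'" "ereal c' < g y"
      by (metis ereal_dense3 not_le)
    have "eventually (\<lambda>n. ereal c' < g (u n)) sequentially"
      using Gamma0_lscD[OF assms c'(2)] y unfolding filterlim_iff by blast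
    moreover have "eventually (\<lambda>n. m + inverse (real (Suc n)) - (norm (u n - x))\<^sup>2 / 2 < c') sequentially"
      using c'(1) by (intro order_tendstoD(2)[OF lim]) (simp add: c_def)
    ultimately have "eventually (\<lambda>n. False) sequentially"
    proof eventually_elim
      case (elim n)
      then show ?case using us(1)[of n] us(2)[of n] by simp
    qed
    then show False by simp
  qed
  then obtain r where r: "g y = ereal r" "r \<le> c"
    using Gamma0_not_MInf[OF assms, of y] by (cases "g y") auto
  show thesis
    using r m_le by (intro that[OF r(1)]) (fastforce simp: c_def)
qed

text \<open>
  Optimality along the segment from the minimizer \<open>y\<close> to \<open>z\<close>, divided by the segment parameter and
  passed to the limit, is the subgradient inequality for \<open>x - y\<close> at \<open>y\<close>.
\<close>

lemma Gamma0_proximal_point_exists: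
  assumes "g \<in> Gamma0"
  shows "\<exists>y. x - y \<in> subdiff g y"
proof -
  obtain y r where y: "g y = ereal r"
    and min: "\<And>z s. g z = ereal s \<Longrightarrow> r + (norm (y - x))\<^sup>2 / 2 \<le> s + (norm (z - x))\<^sup>2 / 2"
    using Gamma0_regularization_has_minimizer[OF assms] by metis
  have "(x - y) \<bullet> (z - y) \<le> s - r" if z: "g z = ereal s" for z s
  proof -
    have le: "(x - y) \<bullet> (z - y) \<le> s - r + t * ((norm (z - y))\<^sup>2 / 2)" if t: "0 < t" "t \<le> 1" for t
    proof -
      obtain q where q: "g ((1 - t) *\<^sub>R y + t *\<^sub>R z) = ereal q" "q \<le> (1 - t) * r + t * s"
        using Gamma0_convexD[OF assms y z, of t] t by auto
      have "(1 - t) *\<^sub>R y + t *\<^sub>R z - x = (y - x) + t *\<^sub>R (z - y)"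
        by (simp add: algebra_simps)
      then have "r + (norm (y - x))\<^sup>2 / 2 \<le> q + (norm ((y - x) + t *\<^sub>R (z - y)))\<^sup>2 / 2"
        using min[OF q(1)] by (simp only:)
      also have "(norm ((y - x) + t *\<^sub>R (z - y)))\<^sup>2 =
          (norm (y - x))\<^sup>2 - 2 * t * ((x - y) \<bullet> (z - y)) + t\<^sup>2 * (norm (z - y))\<^sup>2"
        unfolding power2_norm_eq_inner
        by (simp add: inner_commute power2_eq_square algebra_simps)
      finally have "t * ((x - y) \<bullet> (z - y)) \<le> t * (s - r + t * ((norm (z - y))\<^sup>2 / 2))"
        using q(2) unfolding distrib_left right_diff_distrib left_diff_distrib power2_eq_square
        by (simp add: mult.assoc add_divide_distrib diff_divide_distrib)
      then show ?thesis using t(1) by simp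
    qed
    have "((\<lambda>t. s - r + t * ((norm (z - y))\<^sup>2 / 2)) \<longlongrightarrow> s - r + 0 * ((norm (z - y))\<^sup>2 / 2)) (at_right 0)"
      by (intro tendsto_intros)
    moreover have "eventually (\<lambda>t. (x - y) \<bullet> (z - y) \<le> s - r + t * ((norm (z - y))\<^sup>2 / 2)) (at_right 0)"
      by (rule eventually_at_rightI[of 0 1]) (rule le, auto)
    ultimately show ?thesis
      using tendsto_lowerbound trivial_limit_at_right_real by fastforce
  qed
  with y have "x - y \<in> subdiff g y"
    by (auto simp: subdiff_real_iff[OF assms])
  then show ?thesis ..
qed

text \<open>
  Monotonicity of the subdifferential: adding the two subgradient inequalities cancels the values
  of \<open>g\<close> and leaves \<open>\<parallel>y - z\<parallel>\<^sup>2 \<le> 0\<close>.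
\<close>

lemma Gamma0_proximal_point_unique:
  assumes "g \<in> Gamma0" "x - y \<in> subdiff g y" "x - z \<in> subdiff g z"
  shows "y = z"
proof -
  obtain r s where "g y = ereal r" "g z = ereal s"
    and "(x - y) \<bullet> (z - y) \<le> s - r" "(x - z) \<bullet> (y - z) \<le> r - s"
    using assms by (auto simp: subdiff_real_iff)
  then have "(y - z) \<bullet> (y - z) \<le> 0"
    by (simp add: inner_diff inner_commute)
  then show ?thesis
    by (metis eq_iff_diff_eq_0 inner_gt_zero_iff not_le)
qed

lemma mem_translate_iff: "x \<in> {u::'a::ab_group_add} + A \<longleftrightarrow> x - u \<in> A"
  by (force simp: set_plus_def)

lemma mem_fprox_iff: "y \<in> fprox f g x \<longleftrightarrow> x - y \<in> subdiff g (prox f y)"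
  by (simp add: fprox_def sv_inverse_def mem_translate_iff)

lemma eq_prox_iff:
  assumes "g \<in> Gamma0"
  shows "y = prox g x \<longleftrightarrow> x - y \<in> subdiff g y"
proof -
  have ex1: "\<exists>!y. x - y \<in> subdiff g y"
    using Gamma0_proximal_point_exists[OF assms] Gamma0_proximal_point_unique[OF assms]
    by blast
  have "prox g x = (THE y. x - y \<in> subdiff g y)"
    by (simp add: prox_def sv_inverse_def mem_translate_iff)
  with theI'[OF ex1] ex1 show ?thesis by auto
qed

lemma prox_subgradient: "g \<in> Gamma0 \<Longrightarrow> x - prox g x \<in> subdiff g (prox g x)"
  using eq_prox_iff by blast

section \<open>Sums\<close>

text \<open>
  For lower semicontinuity of a sum: a strict lower bound for \<open>a + b\<close> splits into strict lower
  bounds for the summands, also when one or both of them are \<open>\<infinity>\<close>.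
\<close>

lemma ereal_less_add_split:
  assumes c: "c < a + b" "c \<noteq> -\<infinity>" and nm: "a \<noteq> -\<infinity>" "b \<noteq> -\<infinity>"
  obtains p q where "c = ereal (p + q)" "ereal p < a" "ereal q < b"
proof -
  obtain c' where c': "c = ereal c'"
    using c by (cases c) auto
  \<comment> \<open>It suffices to choose \<open>q < b\<close> with \<open>c - q < a\<close>.\<close>
  have "\<exists>q. ereal q < b \<and> ereal (c' - q) < a"
  proof (cases a)
    case (real a')
    then have "ereal (c' - a') < b" using c c' nm by (cases b) auto
    then obtain q where "ereal (c' - a') < ereal q" "ereal q < b"
      using ereal_dense3 by blast
    with real show ?thesis by (intro exI[of _ q]) auto
  next
    case PInf
    obtain q where "ereal q < b"
      using nm(2) by (metis ereal_dense3 ereal_infty_less(2))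
    with PInf show ?thesis by auto
  qed (use nm in simp)
  then obtain q where "ereal q < b" "ereal (c' - q) < a" by blast
  with c' show thesis by (intro that[of "c' - q" q]) auto
qed

lemma Gamma0_add:
  assumes f: "f \<in> Gamma0" and g: "g \<in> Gamma0" and dom: "edom f \<inter> edom g \<noteq> {}"
  shows "(\<lambda>u. f u + g u) \<in> Gamma0"
proof -
  note nm = Gamma0_not_MInf[OF f] Gamma0_not_MInf[OF g]
  have "eproper (\<lambda>u. f u + g u)"
    using dom nm by (auto simp: eproper_def edom_def)
  moreover have "elsc (\<lambda>u. f u + g u)"
    unfolding elsc_def le_Liminf_iff
  proof (intro allI impI)
    fix x c assume c: "c < f x + g x"
    have "eventually (\<lambda>u. c < f u + g u) (nhds x)"
    proof (cases "c = -\<infinity>")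
      case True
      then show ?thesis using nm by simp
    next
      case False
      with c obtain p q where pq: "c = ereal (p + q)" "ereal p < f x" "ereal q < g x"
        using ereal_less_add_split[of c "f x" "g x"] nm by metis
      have "eventually (\<lambda>u. ereal p < f u) (nhds x)" "eventually (\<lambda>u. ereal q < g u) (nhds x)"
        using Gamma0_lscD f g pq by blast+
      then show ?thesis
      proof eventually_elim
        case (elim u)
        then have "ereal p + ereal q < f u + g u"
          by (rule ereal_add_strict_mono2)
        with pq(1) show ?case by simp
      qed
    qed
    then show "eventually (\<lambda>u. c < f u + g u) (at x)"
      by (simp add: eventually_nhds_conv_at)
  qed
  moreover have "econvex (\<lambda>u. f u + g u)"
    unfolding econvex_def
  proof (intro allI ballI)
    fix x y :: 'a and t :: real
    assume t: "t \<in> {0..1}"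
    let ?z = "(1 - t) *\<^sub>R x + t *\<^sub>R y"
    have "f ?z \<le> ereal (1 - t) * f x + ereal t * f y"
      "g ?z \<le> ereal (1 - t) * g x + ereal t * g y"
      using f g t by (auto simp: Gamma0_def econvex_def)
    then have "f ?z + g ?z \<le>
      (ereal (1 - t) * f x + ereal t * f y) + (ereal (1 - t) * g x + ereal t * g y)"
      by (rule add_mono)
    also have "\<dots> = ereal (1 - t) * (f x + g x) + ereal t * (f y + g y)"
      by (simp add: ereal_distrib_left nm algebra_simps)
    finally show "f ?z + g ?z \<le> ereal (1 - t) * (f x + g x) + ereal t * (f y + g y)" .
  qed
  ultimately show ?thesis by (simp add: Gamma0_def)
qed

lemma subdiff_add_subset:
  assumes f: "f \<in> Gamma0" and g: "g \<in> Gamma0" and dom: "edom f \<inter> edom g \<noteq> {}"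
  shows "subdiff f x + subdiff g x \<subseteq> subdiff (\<lambda>u. f u + g u) x"
proof
  fix w assume "w \<in> subdiff f x + subdiff g x"
  then obtain a b where w: "w = a + b" and a: "a \<in> subdiff f x" and b: "b \<in> subdiff g x"
    by (auto elim: set_plus_elim)
  from a obtain r where r: "f x = ereal r" "\<And>z s. f z = ereal s \<Longrightarrow> a \<bullet> (z - x) \<le> s - r"
    by (auto simp: subdiff_real_iff[OF f])
  from b obtain q where q: "g x = ereal q" "\<And>z s. g z = ereal s \<Longrightarrow> b \<bullet> (z - x) \<le> s - q"
    by (auto simp: subdiff_real_iff[OF g])
  have "w \<bullet> (z - x) \<le> s - (r + q)" if "f z + g z = ereal s" for z s
  proof -
    from that obtain s1 s2 where "f z = ereal s1" "g z = ereal s2" "s = s1 + s2"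
      by (cases "f z"; cases "g z") auto
    with r(2)[of z s1] q(2)[of z s2] show ?thesis
      by (simp add: w inner_add_left)
  qed
  with r(1) q(1) show "w \<in> subdiff (\<lambda>u. f u + g u) x"
    by (auto simp: subdiff_real_iff[OF Gamma0_add[OF f g dom]])
qed

section \<open>The composition formula\<close>

text \<open>
  If \<open>y = prox g x\<close> is a point of \<open>fprox f g x\<close> and \<open>z = prox f y\<close>, then \<open>x - z\<close> splits as
  \<open>(y - z) + (x - y)\<close> into a subgradient of \<open>f\<close> and one of \<open>g\<close>, both at \<open>z\<close>. This locates
  \<open>prox (f + g) x\<close>. Every \<open>w \<in> \<partial>(f + g)(z)\<close> occurs in this way, with
  \<open>x = z + w\<close>, which gives the sum rule.
\<close>

lemma prox_add_eq_comp_and_C1: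
  assumes f: "f \<in> Gamma0" and g: "g \<in> Gamma0" and dom: "edom f \<inter> edom g \<noteq> {}"
    and mem: "\<And>x. prox g x \<in> fprox f g x"
  shows "prox (\<lambda>u. f u + g u) = prox f \<circ> prox g" "C1 f g"
proof -
  let ?h = "\<lambda>u. f u + g u"
  note h = Gamma0_add[OF f g dom]
  have split: "x - prox f (prox g x) \<in> subdiff f (prox f (prox g x)) + subdiff g (prox f (prox g x))"
    for x
  proof -
    have "(prox g x - prox f (prox g x)) + (x - prox g x)
        \<in> subdiff f (prox f (prox g x)) + subdiff g (prox f (prox g x))"
      using mem[of x] by (intro set_plus_intro prox_subgradient[OF f]) (simp add: mem_fprox_iff)
    then show ?thesis by simp
  qed
  have eq: "prox f (prox g x) = prox ?h x" for x
    using split subdiff_add_subset[OF f g dom] by (simp add: eq_prox_iff[OF h] subset_iff)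
  then show "prox ?h = prox f \<circ> prox g" by auto
  have "w \<in> subdiff f z + subdiff g z" if "w \<in> subdiff ?h z" for w z
  proof -
    have "z = prox ?h (z + w)"
      using that by (simp add: eq_prox_iff[OF h])
    then show ?thesis
      using split[of "z + w"] by (simp add: eq)
  qed
  then show "C1 f g"
    using subdiff_add_subset[OF f g dom] by (fastforce simp: C1_def)
qed

text \<open>
  For \<open>z = prox (f + g) x\<close>, the sum rule splits \<open>x - z\<close> as \<open>a + b\<close> with \<open>a \<in> \<partial>f(z)\<close> and
  \<open>b \<in> \<partial>g(z)\<close>. Then \<open>prox f (z + a) = z\<close>, so \<open>x - (z + a) = b\<close> is the required subgradient of
  \<open>g\<close> at \<open>prox f (z + a)\<close>.
\<close>

lemma C1_imp_fprox_nonempty: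
  assumes f: "f \<in> Gamma0" and g: "g \<in> Gamma0" and dom: "edom f \<inter> edom g \<noteq> {}"
    and "C1 f g"
  shows "fprox f g x \<noteq> {}"
proof -
  define z where "z = prox (\<lambda>u. f u + g u) x"
  have "x - z \<in> subdiff f z + subdiff g z"
    using prox_subgradient[OF Gamma0_add[OF f g dom], of x] \<open>C1 f g\<close>
    by (simp add: C1_def z_def)
  then obtain a b where ab: "x - z = a + b" "a \<in> subdiff f z" "b \<in> subdiff g z"
    by (auto elim: set_plus_elim)
  have "z = prox f (z + a)"
    using ab(2) by (simp add: eq_prox_iff[OF f])
  moreover have "x - (z + a) = b"
    using ab(1) by (simp add: algebra_simps)
  ultimately have "z + a \<in> fprox f g x"
    using ab(3) by (simp add: mem_fprox_iff)
  then show ?thesis by blast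
qed

lemma C3_imp_fprox_subset:
  assumes "g \<in> Gamma0" "C3 f g"
  shows "fprox f g x \<subseteq> {prox g x}"
  using assms by (auto simp: mem_fprox_iff C3_def eq_prox_iff subset_iff)

theorem proposition2p13:
  fixes f g :: "'a::{real_inner, complete_space} \<Rightarrow> ereal"
  assumes "f \<in> Gamma0" and "g \<in> Gamma0" and "edom f \<inter> edom g \<noteq> {}"
  shows "(C2 f g \<longrightarrow>
            (\<forall>x. prox g x \<in> fprox f g x) \<and>
            C1 f g \<and> prox (\<lambda>u. f u + g u) = prox f \<circ> prox g)
       \<and> (C1 f g \<and> C3 f g \<longrightarrow>
            (\<forall>x. fprox f g x = {prox g x}) \<and>
            C1 f g \<and> prox (\<lambda>u. f u + g u) = prox f \<circ> prox g)"
proof (intro conjI impI)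
  note comp = prox_add_eq_comp_and_C1[OF assms]
  {
    assume C2: "C2 f g"
    have mem: "prox g x \<in> fprox f g x" for x
      using prox_subgradient[OF assms(2), of x] C2
      by (auto simp: mem_fprox_iff C2_def)
    then show "\<forall>x. prox g x \<in> fprox f g x" by blast
    show "C1 f g" "prox (\<lambda>u. f u + g u) = prox f \<circ> prox g"
      using comp mem by blast+
  }
  assume C: "C1 f g \<and> C3 f g"
  have eq: "fprox f g x = {prox g x}" for x
    using C1_imp_fprox_nonempty[OF assms] C3_imp_fprox_subset[OF assms(2)] C by blast
  then show "\<forall>x. fprox f g x = {prox g x}" by blast
  show "C1 f g" using C ..
  show "prox (\<lambda>u. f u + g u) = prox f \<circ> prox g"
    using comp eq by blast
qed

end
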